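(* The proximal shift space $Z=\bigcap_{n=1}^\infty Z_n$, where $Z_n$ is the sofic shift presented by the labelled graph $G_n$ described in the context, has the vague specification property.
   Context: $\mathbb{N}_0=\{0,1,2,\ldots\}$, $\mathbb{N}=\{1,2,\ldots\}$. Let $\mathscr{A}=\{0,1\}$ and let $\mathscr{A}^\infty$ be the set of all sequences $x=\{x_n\}_{n=0}^\infty$ over $\mathscr{A}$, with the metric $\rho(x,y)=0$ if $x=y$ and $\rho(x,y)=2^{-\min\{n: x_n\ne y_n\}}$ otherwise (compatible with the product topology). The shift map is $\sigma(x)=\{x_{n+1}\}_{n=0}^\infty$. A shift space is a nonempty, closed, $\sigma$-invariant set $X\subseteq\mathscr{A}^\infty$, viewed as the topological dynamical system $(X,\sigma)$. For $n\in\mathbb{N}$ let $G_n$ be the oriented labelled multigraph with vertex set $\{v_0,v_1,\ldots,v_{10^n-1}\}$ (indices of vertices read modulo $10^n$) and the following labelled edges: (i) for every $0\le k<10^n$ an edge from $v_k$ to $v_{k+1}$ with label $0$; (ii) for every $1\le k\le 10^n-2^n$ an edge from $v_k$ to $v_{k+1}$ with label $1$; (iii) an edge from $v_{10^n-2^n}$ to $v_{10^n-2^n+2}$ with label $0$. $Z_n\subseteq\mathscr{A}^\infty$ is the set of all label sequences of infinite paths in $G_n$ (starting at any vertex). The shift space $Z$ is already known to be proximal (i.e. $\liminf_{n\to\infty}\rho(\sigma^n(x),\sigma^n(y))=0$ for all $x,y\in Z$); the claim to be proved is that it has the vague specification property. For $A\subseteq\mathbb{N}_0$ we write $d(A)=1$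 if $\lim_{n\to\infty}\frac{|A\cap[0,n)|}{n}=1$. For a shift space $X$, $X^\infty$ is the set of all sequences $\underline{x}=\{x^{(n)}\}_{n=0}^\infty$ of points of $X$, with the product topology; $S(\underline{x})=\{x^{(n+1)}\}_{n=0}^\infty$; $\Gamma_\sigma=\{\{\sigma^n(z)\}_{n=0}^\infty: z\in X\}\subseteq X^\infty$. Vague pseudo-orbit: $\underline{x}\in X^\infty$ such that for every open set $\mathcal{U}\subseteq X^\infty$ containing $\Gamma_\sigma$, $d(\{n\in\mathbb{N}_0: S^n(\underline{x})\in\mathcal{U}\})=1$. Vague specification property: for every vague pseudo-orbit $\underline{x}\in X^\infty$ there is $z\in X$ such that for every $\varepsilon>0$, $d(\{n\in\mathbb{N}_0:\rho(\sigma^n(z),x^{(n)})<\varepsilon\})=1$. *)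

theory Defs
  imports "HOL-Analysis.Analysis"
begin

text \<open>
  The alphabet \<open>{0, 1}\<close> is the type \<^typ>\<open>bool\<close> (\<open>0\<close> is \<^const>\<open>False\<close>, \<open>1\<close> is \<^const>\<open>True\<close>), so the full
  shift is the whole type \<^typ>\<open>nat \<Rightarrow> bool\<close>.  The type class topology on function types is the product
  topology and the one on \<^typ>\<open>bool\<close> is discrete; this also covers the iterated product
  \<^typ>\<open>nat \<Rightarrow> nat \<Rightarrow> bool\<close> of sequences of points.
\<close>

definition rho :: "(nat \<Rightarrow> bool) \<Rightarrow> (nat \<Rightarrow> bool) \<Rightarrow> real" where
  "rho x y = (if x = y then 0 else (1 / 2) ^ (LEAST n. x n \<noteq> y n))"

text \<open>Polymorphic: used as \<open>\<sigma>\<close> on points and as \<open>S\<close> on sequences of points.\<close>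

definition shift :: "(nat \<Rightarrow> 'a) \<Rightarrow> nat \<Rightarrow> 'a" where
  "shift x = (\<lambda>n. x (Suc n))"

definition shift_space :: "(nat \<Rightarrow> bool) set \<Rightarrow> bool" where
  "shift_space X \<longleftrightarrow> X \<noteq> {} \<and> closed X \<and> shift ` X \<subseteq> X"

definition density_one :: "nat set \<Rightarrow> bool" where
  "density_one A \<longleftrightarrow> (\<lambda>n. real (card (A \<inter> {0..<n})) / real n) \<longlonglongrightarrow> 1"

definition point_seqs :: "(nat \<Rightarrow> bool) set \<Rightarrow> (nat \<Rightarrow> nat \<Rightarrow> bool) set" where
  "point_seqs X = {x. \<forall>n. x n \<in> X}"

definition orbit_seqs :: "(nat \<Rightarrow> bool) set \<Rightarrow> (nat \<Rightarrow> nat \<Rightarrow> bool) set" where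
  "orbit_seqs X = {(\<lambda>n. (shift ^^ n) z) | z. z \<in> X}"

definition vague_pseudo_orbit :: "(nat \<Rightarrow> bool) set \<Rightarrow> (nat \<Rightarrow> nat \<Rightarrow> bool) \<Rightarrow> bool" where
  "vague_pseudo_orbit X x \<longleftrightarrow> x \<in> point_seqs X \<and>
     (\<forall>U. openin (top_of_set (point_seqs X)) U \<and> orbit_seqs X \<subseteq> U \<longrightarrow>
        density_one {n. (shift ^^ n) x \<in> U})"

definition vague_specification :: "(nat \<Rightarrow> bool) set \<Rightarrow> bool" where
  "vague_specification X \<longleftrightarrow>
     (\<forall>x. vague_pseudo_orbit X x \<longrightarrow>
        (\<exists>z\<in>X. \<forall>\<epsilon>>0. density_one {n. rho ((shift ^^ n) z) (x n) < \<epsilon>}))"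

text \<open>
  A labelled edge is a triple (source, label, target).  A set of triples suffices for the
  multigraphs below, since parallel edges there always carry different labels.
\<close>

type_synonym edge = "nat \<times> bool \<times> nat"

definition infinite_path :: "edge set \<Rightarrow> (nat \<Rightarrow> edge) \<Rightarrow> bool" where
  "infinite_path E e \<longleftrightarrow> (\<forall>i. e i \<in> E \<and> snd (snd (e i)) = fst (e (Suc i)))"

definition presented_shift :: "edge set \<Rightarrow> (nat \<Rightarrow> bool) set" where
  "presented_shift E = {(\<lambda>i. fst (snd (e i))) | e. infinite_path E e}"

text \<open>The vertex \<open>v\<^sub>k\<close> is the number \<open>k < 10 ^ n\<close>; the vertex set is the set of edge sources.\<close>

definition G :: "nat \<Rightarrow> edge set" where
  "G n = {(k, False, (k + 1) mod 10 ^ n) | k. k < 10 ^ n}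
       \<union> {(k, True, (k + 1) mod 10 ^ n) | k. 1 \<le> k \<and> k \<le> 10 ^ n - 2 ^ n}
       \<union> {(10 ^ n - 2 ^ n, False, (10 ^ n - 2 ^ n + 2) mod 10 ^ n)}"

definition Z_level :: "nat \<Rightarrow> (nat \<Rightarrow> bool) set" where
  "Z_level n = presented_shift (G n)"

definition Z :: "(nat \<Rightarrow> bool) set" where
  "Z = (\<Inter>n\<in>{1..}. Z_level n)"

lemma finite_G: "finite (G n)"
  unfolding G_def by (auto simp: setcompr_eq_image)

lemma closed_presented_shift:
  assumes "finite E"
  shows "closed (presented_shift E)"
proof -
  have "compactin (product_topology (\<lambda>_::nat. euclidean) UNIV) (PiE UNIV (\<lambda>_. E))"
    using assms by (simp add: compactin_PiE finite_imp_compact)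
  then have "compact {e :: nat \<Rightarrow> edge. \<forall>i. e i \<in> E}"
    by (simp add: euclidean_product_topology PiE_UNIV_domain Pi_def)
  moreover have "closed {e :: nat \<Rightarrow> edge. \<forall>i. snd (snd (e i)) = fst (e (Suc i))}"
    by (intro closed_Collect_all closed_Collect_eq continuous_intros continuous_on_product_coordinates)
  ultimately have "compact ({e. \<forall>i. e i \<in> E} \<inter> {e. \<forall>i. snd (snd (e i)) = fst (e (Suc i))})"
    by (rule compact_Int_closed)
  moreover have "{e. \<forall>i. e i \<in> E} \<inter> {e. \<forall>i. snd (snd (e i)) = fst (e (Suc i))} = Collect (infinite_path E)"
    by (auto simp: infinite_path_def)
  moreover have "continuous_on (Collect (infinite_path E)) (\<lambda>e i. fst (snd (e i)))"
    by (intro continuous_on_coordinatewise_then_product continuous_intros continuous_on_subset[OF continuous_on_product_coordinates]) auto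
  ultimately have "compact ((\<lambda>e i. fst (snd (e i))) ` Collect (infinite_path E))"
    by (metis compact_continuous_image)
  moreover have "presented_shift E = (\<lambda>e i. fst (snd (e i))) ` Collect (infinite_path E)"
    by (auto simp: presented_shift_def)
  moreover have "Hausdorff_space (euclidean :: (nat \<Rightarrow> bool) topology)"
    unfolding euclidean_product_topology[symmetric] Hausdorff_space_product_topology
    by (metis (full_types) Hausdorff_space_def disjnt_def hausdorff open_openin)
  ultimately show ?thesis
    by (metis closed_closedin compactin_euclidean_iff compactin_imp_closedin)
qed

lemma shift_presented_shift: "shift ` presented_shift E \<subseteq> presented_shift E"
proof clarify
  fix x assume "x \<in> presented_shift E"
  then obtain e where e: "infinite_path E e" "x = (\<lambda>i. fst (snd (e i)))"
    by (auto simp: presented_shift_def)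
  then have "infinite_path E (shift e)" "shift x = (\<lambda>i. fst (snd (shift e i)))"
    by (auto simp: infinite_path_def shift_def)
  then show "shift x \<in> presented_shift E" by (auto simp: presented_shift_def)
qed

lemma zero_in_Z_level: "(\<lambda>_. False) \<in> Z_level n"
proof -
  let ?e = "\<lambda>i. (i mod 10 ^ n, False, (i + 1) mod 10 ^ n)"
  have "infinite_path (G n) ?e"
    by (auto simp: infinite_path_def G_def mod_Suc_eq)
  then show ?thesis
    unfolding Z_level_def presented_shift_def by (auto intro!: exI[of _ ?e])
qed

lemma shift_space_Z_level: "shift_space (Z_level n)"
  using zero_in_Z_level[of n] closed_presented_shift[OF finite_G[of n]] shift_presented_shift[of "G n"]
  by (auto simp: shift_space_def Z_level_def)

lemma shift_space_Z: "shift_space Z"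
  unfolding shift_space_def
proof (intro conjI)
  show "Z \<noteq> {}" using zero_in_Z_level by (auto simp: Z_def)
  show "closed Z" using shift_space_Z_level by (auto simp: Z_def shift_space_def)
  show "shift ` Z \<subseteq> Z" using shift_space_Z_level by (fastforce simp: Z_def shift_space_def)
qed

end

theory Submission
  imports Defs
begin

text \<open>
  Let \<open>w\<close> be the sequence of first symbols of a vague pseudo-orbit; for every \<open>l\<close>, almost every
  window of \<open>w\<close> of length \<open>l\<close> is a word of \<open>Z\<close>, and it suffices to find a point of \<open>Z\<close> that
  agrees with \<open>w\<close> on a set of density one.  For a fixed level \<open>n\<close>, cut \<open>w\<close> greedily into words
  of \<open>Z\<^sub>n\<close>; the cuts have density zero.  Any two vertices of \<open>G\<^sub>n\<close> are joined by a
  zero word of one fixed length, and \<open>Z\<^sub>n\<close> is hereditary, so replacing a bounded number of symbols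
  after each cut by zeros yields a point \<open>y\<^sub>n\<close> of \<open>Z\<^sub>n\<close>.  Up to a late time one instead
  imposes the periodic zero blocks of \<open>G\<^sub>n\<close>, which have density \<open>5\<^sup>-\<^sup>n\<close>; then \<open>y\<^sub>n\<close> differs from
  \<open>w\<close> in at most \<open>2 m / 5\<^sup>n\<close> places below \<open>m\<close>, for every \<open>m\<close>.  By dominated convergence the
  coordinatewise minimum of \<open>w\<close> and all \<open>y\<^sub>n\<close> still agrees with \<open>w\<close> on density one, and it lies
  in every \<open>Z\<^sub>n\<close> because these are hereditary.
\<close>

section \<open>Sets of density zero\<close>

text \<open>Density zero with the quotient cleared, so that counting bounds can be added without
  dividing by \<open>m\<close>.\<close>

definition null_set :: "nat set \<Rightarrow> bool" where
  "null_set A \<longleftrightarrow> (\<forall>\<epsilon>>0. \<forall>\<^sub>F m in sequentially. real (card (A \<inter> {0..<m})) \<le> \<epsilon> * real m)"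

lemma null_set_eventually:
  "null_set A \<Longrightarrow> \<epsilon> > 0 \<Longrightarrow> \<forall>\<^sub>F m in sequentially. real (card (A \<inter> {0..<m})) \<le> \<epsilon> * real m"
  unfolding null_set_def by blast

lemma null_setD:
  assumes "null_set A" "\<epsilon> > 0"
  obtains m0 where "\<And>m. m \<ge> m0 \<Longrightarrow> real (card (A \<inter> {0..<m})) \<le> \<epsilon> * real m"
  using assms unfolding null_set_def eventually_sequentially by blast

lemma density_one_iff_null_set: "density_one A \<longleftrightarrow> null_set (- A)"
proof -
  have *: "real (card (A \<inter> {0..<m})) / real m = 1 - real (card (- A \<inter> {0..<m})) / real m"
    if "m > 0" for m
  proof -
    have "card {0..<m} = card (A \<inter> {0..<m}) + card (- A \<inter> {0..<m})"
      by (subst card_Un_disjoint[symmetric]) (auto simp del: card_atLeastLessThan intro!: arg_cong[where f = card])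
    then have "real m = real (card (A \<inter> {0..<m})) + real (card (- A \<inter> {0..<m}))"
      by simp
    with that show ?thesis by (simp add: field_simps)
  qed
  have "density_one A \<longleftrightarrow> (\<lambda>m. 1 - real (card (- A \<inter> {0..<m})) / real m) \<longlonglongrightarrow> 1"
    unfolding density_one_def
    by (intro tendsto_cong eventually_mono[OF eventually_gt_at_top[of 0]] *)
  also have "\<dots> \<longleftrightarrow> (\<lambda>m. real (card (- A \<inter> {0..<m})) / real m) \<longlonglongrightarrow> 0"
    using tendsto_diff[OF tendsto_const[of "1::real"], of _ 0] tendsto_diff[OF tendsto_const[of "1::real"], of _ 1]
    by fastforce
  also have "\<dots> \<longleftrightarrow> null_set (- A)"
  proof
    assume "(\<lambda>m. real (card (- A \<inter> {0..<m})) / real m) \<longlonglongrightarrow> 0"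
    then have ev: "\<forall>\<^sub>F m in sequentially. real (card (- A \<inter> {0..<m})) / real m < \<epsilon>" if "\<epsilon> > 0" for \<epsilon>
      using that by (rule order_tendstoD)
    show "null_set (- A)"
      unfolding null_set_def
    proof (intro allI impI)
      fix \<epsilon> :: real assume "\<epsilon> > 0"
      show "\<forall>\<^sub>F m in sequentially. real (card (- A \<inter> {0..<m})) \<le> \<epsilon> * real m"
        using ev[OF \<open>\<epsilon> > 0\<close>] eventually_gt_at_top[of 0]
        by eventually_elim (simp add: field_simps)
    qed
  next
    assume N: "null_set (- A)"
    show "(\<lambda>m. real (card (- A \<inter> {0..<m})) / real m) \<longlonglongrightarrow> 0"
    proof (rule order_tendstoI)
      fix \<epsilon> :: real assume "\<epsilon> > 0"
      then have "\<forall>\<^sub>F m in sequentially. real (card (- A \<inter> {0..<m})) \<le> \<epsilon> / 2 * real m"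
        by (intro null_set_eventually[OF N] half_gt_zero)
      with eventually_gt_at_top[of 0]
      show "\<forall>\<^sub>F m in sequentially. real (card (- A \<inter> {0..<m})) / real m < \<epsilon>"
      proof eventually_elim
        case (elim m)
        then have "real (card (- A \<inter> {0..<m})) / real m \<le> \<epsilon> / 2" by (simp add: field_simps)
        with \<open>\<epsilon> > 0\<close> show ?case by linarith
      qed
    next
      fix \<epsilon> :: real assume "\<epsilon> < 0"
      then show "\<forall>\<^sub>F m in sequentially. \<epsilon> < real (card (- A \<inter> {0..<m})) / real m"
        by (intro always_eventually allI less_le_trans[OF _ divide_nonneg_nonneg]) auto
    qed
  qed
  finally show ?thesis .
qed

lemma null_set_subset: "null_set B \<Longrightarrow> A \<subseteq> B \<Longrightarrow> null_set A"
  unfolding null_set_def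
proof (intro allI impI)
  fix \<epsilon> :: real
  assume "\<forall>\<epsilon>>0. \<forall>\<^sub>F m in sequentially. real (card (B \<inter> {0..<m})) \<le> \<epsilon> * real m" "A \<subseteq> B" "\<epsilon> > 0"
  then have "\<forall>\<^sub>F m in sequentially. real (card (B \<inter> {0..<m})) \<le> \<epsilon> * real m" by blast
  then show "\<forall>\<^sub>F m in sequentially. real (card (A \<inter> {0..<m})) \<le> \<epsilon> * real m"
  proof eventually_elim
    case (elim m)
    have "card (A \<inter> {0..<m}) \<le> card (B \<inter> {0..<m})"
      using \<open>A \<subseteq> B\<close> by (intro card_mono) auto
    with elim show ?case by linarith
  qed
qed

lemma null_set_Un:
  assumes "null_set A" "null_set B"
  shows "null_set (A \<union> B)"
  unfolding null_set_def
proof (intro allI impI)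
  fix \<epsilon> :: real assume "\<epsilon> > 0"
  then have "\<epsilon> / 2 > 0" by simp
  from assms[THEN null_set_eventually, OF this]
  show "\<forall>\<^sub>F m in sequentially. real (card ((A \<union> B) \<inter> {0..<m})) \<le> \<epsilon> * real m"
  proof eventually_elim
    case (elim m)
    have "card ((A \<union> B) \<inter> {0..<m}) \<le> card (A \<inter> {0..<m}) + card (B \<inter> {0..<m})"
      by (metis Int_Un_distrib2 card_Un_le)
    with elim show ?case by linarith
  qed
qed

lemma null_set_finite: "finite A \<Longrightarrow> null_set A"
  unfolding null_set_def
proof (intro allI impI)
  fix \<epsilon> :: real assume "finite A" "\<epsilon> > 0"
  have "\<forall>\<^sub>F m in sequentially. real (card A) / \<epsilon> \<le> real m"
    using filterlim_real_sequentially by (simp add: filterlim_at_top)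
  then show "\<forall>\<^sub>F m in sequentially. real (card (A \<inter> {0..<m})) \<le> \<epsilon> * real m"
  proof eventually_elim
    case (elim m)
    have "card (A \<inter> {0..<m}) \<le> card A"
      using \<open>finite A\<close> by (intro card_mono) auto
    moreover have "real (card A) \<le> \<epsilon> * real m"
      using elim \<open>\<epsilon> > 0\<close> by (simp add: field_simps)
    ultimately show ?case by linarith
  qed
qed

lemma null_set_UN:
  assumes "finite I" "\<And>i. i \<in> I \<Longrightarrow> null_set (A i)"
  shows "null_set (\<Union>i\<in>I. A i)"
  using assms by (induction I rule: finite_induct) (auto intro: null_set_Un null_set_finite)

text \<open>Below \<open>m\<close> the map \<open>f\<close> sends \<open>B\<close> injectively into
  \<open>A\<close> below \<open>m + k\<close>; for \<open>m >= k\<close> this at most doubles the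
  length, which halving \<open>\<epsilon>\<close> pays for. Translations in both directions are
  instances.\<close>

lemma null_set_inj_vimage_le:
  assumes "null_set A" "\<And>i. i \<in> B \<Longrightarrow> f i \<in> A" "inj_on f B" "\<And>i. i \<in> B \<Longrightarrow> f i \<le> i + k"
  shows "null_set B"
  unfolding null_set_def
proof (intro allI impI)
  fix \<epsilon> :: real assume "\<epsilon> > 0"
  then obtain m0 where m0: "\<And>m. m \<ge> m0 \<Longrightarrow> real (card (A \<inter> {0..<m})) \<le> \<epsilon> / 2 * real m"
    using null_setD[OF assms(1), of "\<epsilon> / 2"] by auto
  have "real (card (B \<inter> {0..<m})) \<le> \<epsilon> * real m" if "m \<ge> m0" "m \<ge> k" for m
  proof -
    have "card (B \<inter> {0..<m}) \<le> card (A \<inter> {0..<m + k})"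
    proof (rule card_inj_on_le[of f])
      show "inj_on f (B \<inter> {0..<m})" by (rule inj_on_subset[OF assms(3)]) simp
      show "f ` (B \<inter> {0..<m}) \<subseteq> A \<inter> {0..<m + k}" using assms(2,4) by fastforce
    qed simp
    moreover have "real (card (A \<inter> {0..<m + k})) \<le> \<epsilon> / 2 * real (m + k)"
      using that by (intro m0) simp
    moreover have "\<epsilon> / 2 * real (m + k) \<le> \<epsilon> / 2 * (2 * real m)"
      using that \<open>\<epsilon> > 0\<close> by (intro mult_left_mono) auto
    ultimately show ?thesis by simp
  qed
  then show "\<forall>\<^sub>F m in sequentially. real (card (B \<inter> {0..<m})) \<le> \<epsilon> * real m"
    unfolding eventually_sequentially by (metis max.bounded_iff)
qed

lemma null_set_plus: "null_set A \<Longrightarrow> null_set ((\<lambda>i. i + k) ` A)"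
  by (rule null_set_inj_vimage_le[of A _ "\<lambda>i. i - k" 0]) (auto simp: inj_on_def)

lemma null_set_minus: "null_set A \<Longrightarrow> null_set {i. i + k \<in> A}"
  by (rule null_set_inj_vimage_le[of A _ "\<lambda>i. i + k" k]) (auto simp: inj_on_def)

text \<open>Dominated convergence for counting: finitely many \<open>E n\<close> have a null union,
  and the others fill at most \<open>m\<close> times a tail of the series \<open>c\<close>,
  uniformly in \<open>m\<close>.\<close>

lemma null_set_UN_dominated:
  assumes null: "\<And>n. null_set (E n)"
    and bound: "\<And>n m. real (card (E n \<inter> {0..<m})) \<le> c n * real m"
    and c: "summable c"
  shows "null_set (\<Union>n. E n)"
  unfolding null_set_def
proof (intro allI impI)
  fix \<epsilon> :: real assume "\<epsilon> > 0"
  have c0: "c n \<ge> 0" for n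
    using bound[of n 1] of_nat_0_le_iff[of "card (E n \<inter> {0..<1})", where ?'a = real] by simp
  from \<open>\<epsilon> > 0\<close> obtain N where N: "\<And>m k. m \<ge> N \<Longrightarrow> norm (sum c {m..<k}) < \<epsilon> / 2"
    using c unfolding summable_Cauchy by (metis half_gt_zero)
  have "null_set (\<Union>n\<in>{..<N}. E n)"
    using null by (intro null_set_UN) auto
  then have "\<forall>\<^sub>F m in sequentially. real (card ((\<Union>n\<in>{..<N}. E n) \<inter> {0..<m})) \<le> \<epsilon> / 2 * real m"
    using \<open>\<epsilon> > 0\<close> by (intro null_set_eventually half_gt_zero)
  then show "\<forall>\<^sub>F m in sequentially. real (card ((\<Union>n. E n) \<inter> {0..<m})) \<le> \<epsilon> * real m"
  proof eventually_elim
    case (elim m)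
    let ?A = "(\<Union>n\<in>{..<N}. E n) \<inter> {0..<m}"
    \<comment> \<open>Below \<open>m\<close> only finitely many indices matter, so the tail is a
      finite sum over \<open>{N..<k}\<close>, which the Cauchy criterion bounds.\<close>
    have "\<exists>k. \<forall>i\<in>{0..<m} \<inter> (\<Union>n. E n). \<exists>n<k. i \<in> E n"
    proof -
      have "\<forall>i\<in>{0..<m} \<inter> (\<Union>n. E n). \<exists>n. i \<in> E n" by blast
      then obtain g where g: "\<forall>i\<in>{0..<m} \<inter> (\<Union>n. E n). i \<in> E (g i)" by metis
      have "finite (g ` {0..<m})" by simp
      then obtain k where "\<forall>x\<in>g ` {0..<m}. x < k"
        using finite_nat_set_iff_bounded by auto
      with g show ?thesis by blast
    qed
    then obtain k where k: "\<forall>i\<in>{0..<m} \<inter> (\<Union>n. E n). \<exists>n<k. i \<in> E n" by blast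
    have "(\<Union>n. E n) \<inter> {0..<m} \<subseteq> ?A \<union> (\<Union>n\<in>{N..<k}. E n \<inter> {0..<m})"
    proof
      fix i assume i: "i \<in> (\<Union>n. E n) \<inter> {0..<m}"
      with k obtain n where "n < k" "i \<in> E n" by blast
      with i show "i \<in> ?A \<union> (\<Union>n\<in>{N..<k}. E n \<inter> {0..<m})"
        by (cases "n < N") auto
    qed
    then have "card ((\<Union>n. E n) \<inter> {0..<m}) \<le> card (?A \<union> (\<Union>n\<in>{N..<k}. E n \<inter> {0..<m}))"
      by (intro card_mono) auto
    also have "\<dots> \<le> card ?A + card (\<Union>n\<in>{N..<k}. E n \<inter> {0..<m})" by (rule card_Un_le)
    also have "card (\<Union>n\<in>{N..<k}. E n \<inter> {0..<m}) \<le> (\<Sum>n\<in>{N..<k}. card (E n \<inter> {0..<m}))"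
      by (rule card_UN_le) simp
    finally have "card ((\<Union>n. E n) \<inter> {0..<m}) \<le> card ?A + (\<Sum>n\<in>{N..<k}. card (E n \<inter> {0..<m}))"
      by simp
    then have "real (card ((\<Union>n. E n) \<inter> {0..<m})) \<le> real (card ?A + (\<Sum>n\<in>{N..<k}. card (E n \<inter> {0..<m})))"
      by (rule of_nat_mono)
    also have "\<dots> = real (card ?A) + (\<Sum>n\<in>{N..<k}. real (card (E n \<inter> {0..<m})))"
      by simp
    also have "(\<Sum>n\<in>{N..<k}. real (card (E n \<inter> {0..<m}))) \<le> (\<Sum>n\<in>{N..<k}. c n * real m)"
      by (intro sum_mono bound)
    also have "\<dots> = sum c {N..<k} * real m" by (simp add: sum_distrib_right)
    also have "\<dots> \<le> \<epsilon> / 2 * real m"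
      using N[of N k] by (intro mult_right_mono) auto
    finally show ?case using elim by simp
  qed
qed

text \<open>
  Cut greedily: from the cut \<open>a\<close> jump to the last good endpoint not beyond \<open>2 a + 1\<close>.  A short
  jump from \<open>a\<close> means that a slightly longer interval starting at \<open>a\<close> is not good, which is rare.
\<close>

lemma sparse_good_cuts:
  fixes good :: "nat \<Rightarrow> nat \<Rightarrow> bool"
  assumes step: "\<And>a. good a (Suc a)"
    and rare: "\<And>l. null_set {a. \<not> good a (a + l)}"
  obtains a where "strict_mono a" "\<And>i. good (a i) (a (Suc i))" "null_set (range a)"
proof -
  \<comment> \<open>The cap \<open>2 * a + 1\<close> makes the maximum exist, admits
    \<open>Suc a\<close> even at \<open>a = 0\<close>, and admits a jump of length \<open>l\<close>
    as soon as \<open>l <= a\<close>.\<close>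
  define nxt where "nxt a = (GREATEST b. a < b \<and> b \<le> 2 * a + 1 \<and> good a b)" for a
  have nxt: "a < nxt a \<and> nxt a \<le> 2 * a + 1 \<and> good a (nxt a)" for a
    unfolding nxt_def by (rule GreatestI_nat[of _ "Suc a" "2 * a + 1"]) (auto simp: step)
  have nxt_max: "b \<le> nxt a" if "a < b" "b \<le> 2 * a + 1" "good a b" for a b
    unfolding nxt_def by (rule Greatest_le_nat[of _ _ "2 * a + 1"]) (use that in auto)
  define a where "a i = (nxt ^^ i) 0" for i
  have a_Suc: "a (Suc i) = nxt (a i)" for i by (simp add: a_def)
  have mono: "strict_mono a" by (intro strict_monoI_Suc) (simp add: a_Suc nxt)
  have "null_set (range a)"
    unfolding null_set_def
  proof (intro allI impI)
    fix \<epsilon> :: real assume "\<epsilon> > 0"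
    obtain l :: nat where l: "2 / \<epsilon> < real l" "l > 0"
      using reals_Archimedean2[of "max 1 (2 / \<epsilon>)"] by force
    \<comment> \<open>Long jumps start at points at least \<open>l\<close> apart, which is sparse
      since \<open>l > 2 / \<epsilon>\<close>. In \<open>Short\<close>, \<open>{..<l}\<close>
      collects the early cuts where the cap may prevent a jump of length \<open>l\<close>.\<close>
    define Long where "Long = {x \<in> range a. x + l \<le> nxt x}"
    define Short where "Short = {..<l} \<union> {x. \<not> good x (x + l)} \<union> {0}"
    have cover: "range a \<subseteq> Short \<union> Long"
    proof
      fix x assume x: "x \<in> range a"
      show "x \<in> Short \<union> Long"
      proof (rule ccontr)
        assume *: "x \<notin> Short \<union> Long"
        then have "good x (x + l)" "l \<le> x" by (auto simp: Short_def)
        then have "x + l \<le> nxt x" using l by (intro nxt_max) auto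
        with * x show False by (auto simp: Long_def)
      qed
    qed
    have sep: "x + l \<le> y" if xy: "x \<in> Long" "y \<in> Long" "x < y" for x y
    proof -
      obtain i j where "x = a i" "y = a j" using xy by (auto simp: Long_def)
      then have "a (Suc i) \<le> y"
        using \<open>x < y\<close> mono by (simp add: strict_mono_less strict_mono_less_eq Suc_le_eq)
      then show ?thesis using xy \<open>x = a i\<close> by (simp add: Long_def a_Suc)
    qed
    have "null_set Short"
      unfolding Short_def by (intro null_set_Un rare null_set_finite) auto
    then have "\<forall>\<^sub>F m in sequentially. real (card (Short \<inter> {0..<m})) \<le> \<epsilon> / 4 * real m"
      using \<open>\<epsilon> > 0\<close> by (intro null_set_eventually divide_pos_pos) auto
    moreover have "\<forall>\<^sub>F m in sequentially. 4 / \<epsilon> \<le> real m"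
      using filterlim_real_sequentially by (simp add: filterlim_at_top)
    ultimately show "\<forall>\<^sub>F m in sequentially. real (card (range a \<inter> {0..<m})) \<le> \<epsilon> * real m"
    proof eventually_elim
      case (elim m)
      \<comment> \<open>Separation puts the members of \<open>Long\<close> into different blocks of
        length \<open>l\<close>, hence at most \<open>m div l + 1\<close> of them below
        \<open>m\<close>.\<close>
      have "inj_on (\<lambda>x. x div l) Long"
      proof (rule linorder_inj_onI)
        fix x y assume "x < y" "x \<in> Long" "y \<in> Long"
        then have "(x + l) div l \<le> y div l" by (intro div_le_mono sep)
        with l show "x div l \<noteq> y div l" by simp
      qed auto
      then have "card (Long \<inter> {0..<m}) \<le> card {0..m div l}"
        by (intro card_inj_on_le[of "\<lambda>x. x div l"]) (auto intro: inj_on_subset intro!: div_le_mono)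
      then have "real (card (Long \<inter> {0..<m})) \<le> real (m div l) + 1" by simp
      also have "real (m div l) \<le> real m / real l" by (rule of_nat_div_le_of_nat)
      also have "\<dots> \<le> \<epsilon> / 2 * real m"
      proof -
        have "2 \<le> \<epsilon> * real l" using l \<open>\<epsilon> > 0\<close> by (simp add: field_simps)
        then have "2 * real m \<le> \<epsilon> * real l * real m" by (intro mult_right_mono) auto
        then show ?thesis using l by (simp add: field_simps)
      qed
      also have "1 \<le> \<epsilon> / 4 * real m" using elim(2) \<open>\<epsilon> > 0\<close> by (simp add: field_simps)
      finally have "real (card (Long \<inter> {0..<m})) \<le> \<epsilon> / 2 * real m + \<epsilon> / 4 * real m" by simp
      moreover have "card (range a \<inter> {0..<m}) \<le> card (Short \<inter> {0..<m}) + card (Long \<inter> {0..<m})"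
        using cover by (intro order_trans[OF card_mono card_Un_le]) auto
      ultimately show ?case using elim(1) by (simp add: field_simps)
    qed
  qed
  with mono nxt show ?thesis by (intro that[of a]) (auto simp: a_Suc)
qed

section \<open>Walks in the graphs\<close>

text \<open>Only the label word and the end vertices are recorded, so that concatenating and
  relabelling paths become operations on lists.\<close>

fun walk :: "edge set \<Rightarrow> nat \<Rightarrow> bool list \<Rightarrow> nat \<Rightarrow> bool" where
  "walk E u [] v \<longleftrightarrow> u = v"
| "walk E u (b # bs) v \<longleftrightarrow> (\<exists>u'. (u, b, u') \<in> E \<and> walk E u' bs v)"

lemma walk_append: "walk E u (xs @ ys) v \<longleftrightarrow> (\<exists>m. walk E u xs m \<and> walk E m ys v)"
  by (induction xs arbitrary: u) auto

lemma walk_of_infinite_path: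
  assumes "infinite_path E e"
  shows "walk E (fst (e a)) (map (\<lambda>i. fst (snd (e i))) [a..<a + l]) (fst (e (a + l)))"
proof (induction l)
  case (Suc l)
  have "(fst (e (a + l)), fst (snd (e (a + l))), fst (e (a + Suc l))) \<in> E"
    using assms unfolding infinite_path_def by (metis add_Suc_right prod.collapse)
  with Suc show ?case by (auto simp: walk_append)
qed simp

lemma infinite_path_prepend_walk:
  assumes "walk E u xs v" "infinite_path E e" "fst (e 0) = v"
  obtains e' where "infinite_path E e'" "fst (e' 0) = u"
    "\<And>i. i < length xs \<Longrightarrow> fst (snd (e' i)) = xs ! i"
  using assms
proof (induction xs arbitrary: u thesis)
  case (Cons b bs)
  then obtain u' where u': "(u, b, u') \<in> E" "walk E u' bs v" by auto
  obtain e' where e': "infinite_path E e'" "fst (e' 0) = u'"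
    "\<And>i. i < length bs \<Longrightarrow> fst (snd (e' i)) = bs ! i"
    using Cons.IH[OF _ u'(2) Cons.prems(3,4)] by blast
  show thesis
  proof (rule Cons.prems(1)[of "case_nat (u, b, u') e'"])
    show "infinite_path E (case_nat (u, b, u') e')"
      using u' e' by (auto simp: infinite_path_def split: nat.split)
    show "fst (snd (case_nat (u, b, u') e' i)) = (b # bs) ! i" if "i < length (b # bs)" for i
      using that e'(3) by (auto split: nat.split)
  qed simp
qed auto

text \<open>Points agreeing with \<open>z\<close> on longer and longer prefixes converge to
  \<open>z\<close> coordinatewise, hence in the product topology.\<close>

lemma closed_if_all_prefixes:
  fixes z :: "nat \<Rightarrow> bool"
  assumes "closed S" and "\<And>m. \<exists>y\<in>S. \<forall>i<m. y i = z i"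
  shows "z \<in> S"
proof -
  obtain y where y: "\<And>m. y m \<in> S" "\<And>m i. i < m \<Longrightarrow> y m i = z i"
    using assms(2) by metis
  have "(\<lambda>m. y m i) \<longlonglongrightarrow> z i" for i
    by (rule tendsto_eventually) (use y(2) in \<open>auto simp: eventually_sequentially intro!: exI[of _ "Suc i"]\<close>)
  then have "limitin (product_topology (\<lambda>_. euclidean) UNIV) y z sequentially"
    by (simp add: limitin_componentwise)
  then have "y \<longlonglongrightarrow> z" by (simp add: euclidean_product_topology)
  with assms(1) y(1) show ?thesis by (rule closed_sequentially)
qed

lemma G_zero_edge: "k < 10 ^ n \<Longrightarrow> (k, False, (k + 1) mod 10 ^ n) \<in> G n"
  by (auto simp: G_def)

text \<open>Every edge labelled 1 has a parallel edge labelled 0; this makes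
  \<open>Z_level n\<close> closed under replacing ones by zeros.\<close>

lemma G_hereditary: "(u, b, v) \<in> G n \<Longrightarrow> (u, False, v) \<in> G n"
  by (auto simp: G_def intro: le_less_trans[OF _ diff_less])

lemma G_source_less: "(u, b, v) \<in> G n \<Longrightarrow> u < 10 ^ n"
  by (auto simp: G_def intro: le_less_trans[OF _ diff_less])

lemma G_target_less: "(u, b, v) \<in> G n \<Longrightarrow> v < 10 ^ n"
  by (auto simp: G_def)

lemma walk_G_target_less: "walk (G n) u xs v \<Longrightarrow> u < 10 ^ n \<Longrightarrow> v < 10 ^ n"
  by (induction xs arbitrary: u) (auto dest: G_target_less)

lemma walk_G_hereditary:
  assumes "walk (G n) u xs v" "length ys = length xs" "\<And>i. i < length xs \<Longrightarrow> ys ! i \<Longrightarrow> xs ! i"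
  shows "walk (G n) u ys v"
  using assms
proof (induction xs arbitrary: u ys)
  case (Cons x xs)
  then obtain y ys' where [simp]: "ys = y # ys'" by (cases ys) auto
  obtain u' where u': "(u, x, u') \<in> G n" "walk (G n) u' xs v" using Cons.prems by auto
  have "(u, y, u') \<in> G n"
    using u'(1) G_hereditary[OF u'(1)] Cons.prems(3)[of 0] by (cases x; cases y) auto
  moreover have "walk (G n) u' ys' v"
    using Cons.IH[OF u'(2), of ys'] Cons.prems(2) Cons.prems(3)[of "Suc _"] by auto
  ultimately show ?case by auto
qed simp

lemma Z_level_hereditary:
  assumes "y \<in> Z_level n" "\<And>i. z i \<Longrightarrow> y i"
  shows "z \<in> Z_level n"
proof -
  obtain e where e: "infinite_path (G n) e" "y = (\<lambda>i. fst (snd (e i)))"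
    using assms(1) by (auto simp: Z_level_def presented_shift_def)
  let ?e = "\<lambda>i. (fst (e i), z i, snd (snd (e i)))"
  have "?e i \<in> G n" for i
  proof -
    have "(fst (e i), y i, snd (snd (e i))) \<in> G n"
      using e by (metis infinite_path_def prod.collapse)
    then show ?thesis using assms(2)[of i] G_hereditary by (cases "z i") auto
  qed
  then have "infinite_path (G n) ?e" using e by (simp add: infinite_path_def)
  then show ?thesis
    unfolding Z_level_def presented_shift_def by (auto intro!: exI[of _ ?e])
qed

lemma walk_G_zeros:
  "walk (G n) (k mod 10 ^ n) (replicate l False) ((k + l) mod 10 ^ n)"
proof (induction l arbitrary: k)
  case (Suc l)
  have "(k mod 10 ^ n, False, (k + 1) mod 10 ^ n) \<in> G n"
    using G_zero_edge[of "k mod 10 ^ n" n] by (simp add: mod_Suc_eq)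
  with Suc[of "k + 1"] show ?case by auto
qed simp

text \<open>Any finite walk extends to an infinite path by running round the zero cycle forever, so
  each prefix of \<open>z\<close> is a prefix of a point of the closed set
  \<open>Z_level n\<close>.\<close>

lemma Z_level_if_all_walks:
  assumes "\<And>m. \<exists>u v. u < 10 ^ n \<and> walk (G n) u (map z [0..<m]) v"
  shows "z \<in> Z_level n"
proof (rule closed_if_all_prefixes)
  show "closed (Z_level n)" using shift_space_Z_level by (simp add: shift_space_def)
  fix m
  obtain u v where uv: "u < 10 ^ n" "walk (G n) u (map z [0..<m]) v" using assms by blast
  then have v: "v < 10 ^ n" using walk_G_target_less by blast
  let ?e = "\<lambda>i. ((v + i) mod 10 ^ n, False, (v + i + 1) mod 10 ^ n)"
  have "?e i \<in> G n" for i
    using G_zero_edge[of "(v + i) mod 10 ^ n" n] by (simp add: mod_Suc_eq)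
  then have path: "infinite_path (G n) ?e" by (simp add: infinite_path_def)
  have start: "fst (?e 0) = v" using v by simp
  obtain e where e: "infinite_path (G n) e"
    "\<And>i. i < length (map z [0..<m]) \<Longrightarrow> fst (snd (e i)) = map z [0..<m] ! i"
    using infinite_path_prepend_walk[OF uv(2) path start] by blast
  then show "\<exists>y\<in>Z_level n. \<forall>i<m. y i = z i"
    by (intro bexI[of _ "\<lambda>i. fst (snd (e i))"]) (auto simp: Z_level_def presented_shift_def)
qed

lemma walk_G_loops:
  assumes "\<And>l. l \<in> set ls \<Longrightarrow> walk (G n) 0 (replicate l False) 0"
  shows "walk (G n) 0 (replicate (sum_list ls) False) 0"
  using assms by (induction ls) (auto simp: replicate_add walk_append)

text \<open>
  The shortcut gives a zero loop at \<open>v\<^sub>0\<close> of length \<open>10\<^sup>n - 1\<close> besides the one of length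
  \<open>10\<^sup>n\<close>; mixing them absorbs the phase difference between \<open>u\<close> and \<open>v\<close>.
\<close>

lemma walk_G_transition:
  assumes "n \<ge> 1" "u < 10 ^ n" "v < 10 ^ n"
  shows "walk (G n) u (replicate (2 * 10 ^ n * 10 ^ n) False) v"
proof -
  define N K :: nat where "N = 10 ^ n" and "K = 2 ^ n"
  have K: "2 \<le> K" "K \<le> N" "u < N" "v < N"
    using assms power_increasing[of 1 n "2::nat"] by (auto simp: N_def K_def power_mono)
  have full: "walk (G n) 0 (replicate N False) 0"
    using walk_G_zeros[of n 0 N] by (simp add: N_def)
  have short: "walk (G n) 0 (replicate (N - 1) False) 0"
  proof -
    have "walk (G n) 0 (replicate (N - K) False) (N - K)"
      using walk_G_zeros[of n 0 "N - K"] K by (simp add: N_def)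
    \<comment> \<open>The shortcut passes over one vertex and so saves one step of the full
      turn.\<close>
    moreover have "walk (G n) (N - K) (replicate 1 False) ((N - K + 2) mod N)"
      by (auto simp: G_def N_def K_def)
    moreover have "walk (G n) ((N - K + 2) mod N) (replicate (K - 2) False) 0"
    proof -
      have "N - K + 2 + (K - 2) = N" using K by simp
      then have "(N - K + 2 + (K - 2)) mod N = 0" by (simp only: mod_self)
      with walk_G_zeros[of n "N - K + 2" "K - 2"] show ?thesis by (metis N_def)
    qed
    ultimately have "walk (G n) 0 (replicate (N - K) False @ replicate 1 False @ replicate (K - 2) False) 0"
      unfolding walk_append by blast
    moreover have "N - K + (1 + (K - 2)) = N - 1" using K by simp
    ultimately show ?thesis by (simp only: replicate_add[symmetric])
  qed
  \<comment> \<open>Going from \<open>u\<close> to \<open>0\<close> and from \<open>0\<close> to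
    \<open>v\<close> takes \<open>d\<close> steps in all. The loops at \<open>0\<close> take
    \<open>2 * N * N - d\<close> steps, as \<open>d\<close> of the \<open>2 * N\<close> turns are
    short; the total no longer depends on \<open>u\<close> and \<open>v\<close>.\<close>
  define d where "d = N - u + v"
  have d: "d \<le> 2 * N" using K by (simp add: d_def)
  let ?ls = "replicate (2 * N - d) N @ replicate d (N - 1)"
  have "walk (G n) 0 (replicate (sum_list ?ls) False) 0"
    by (rule walk_G_loops) (use full short in auto)
  moreover have "walk (G n) u (replicate (N - u) False) 0"
    using walk_G_zeros[of n u "N - u"] K by (simp add: N_def)
  moreover have "walk (G n) 0 (replicate v False) v"
    using walk_G_zeros[of n 0 v] K by (simp add: N_def)
  ultimately have "walk (G n) u (replicate (N - u) False @ replicate (sum_list ?ls) False @ replicate v False) v"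
    unfolding walk_append by blast
  moreover have "N - u + (sum_list ?ls + v) = 2 * N * N"
  proof -
    have "sum_list ?ls + d = (2 * N - d) * N + (d * (N - 1) + d)"
      by (simp add: sum_list_replicate)
    also have "d * (N - 1) + d = d * N" using K by (cases N) auto
    also have "(2 * N - d) * N + d * N = 2 * N * N"
      using d by (simp add: distrib_right[symmetric] mult.assoc)
    finally show ?thesis by (simp add: d_def)
  qed
  ultimately show ?thesis by (simp only: replicate_add[symmetric] N_def)
qed

text \<open>The leading zeros of \<open>ys\<close> lead from \<open>s\<close> to the vertex that
  \<open>xs\<close> reaches after equally many symbols, and from there the old walk is followed. A
  word too short for this consists of zeros, which can be read from any vertex.\<close>

lemma walk_G_resync:
  assumes "n \<ge> 1" "walk (G n) u xs v" "u < 10 ^ n" "s < 10 ^ n" "length ys = length xs"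
    "\<And>i. i < length xs \<Longrightarrow> ys ! i \<Longrightarrow> xs ! i \<and> 2 * 10 ^ n * 10 ^ n \<le> i"
  obtains t where "walk (G n) s ys t"
proof (cases "length xs \<le> 2 * 10 ^ n * 10 ^ n")
  case True
  have "walk (G n) (s mod 10 ^ n) (replicate (length xs) False) ((s + length xs) mod 10 ^ n)"
    by (rule walk_G_zeros)
  then have "walk (G n) (s mod 10 ^ n) ys ((s + length xs) mod 10 ^ n)"
    by (rule walk_G_hereditary) (use assms(5,6) True in fastforce)+
  with assms(4) show thesis by (intro that) simp
next
  case False
  define M :: nat where "M = 2 * 10 ^ n * 10 ^ n"
  obtain m where m: "walk (G n) u (take M xs) m" "walk (G n) m (drop M xs) v"
    using assms(2) walk_append[of "G n" u "take M xs" "drop M xs" v] by auto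
  then have "walk (G n) s (replicate M False) m"
    unfolding M_def by (intro walk_G_transition assms walk_G_target_less[OF m(1)])
  then have "walk (G n) s (replicate M False @ drop M xs) v"
    using m walk_append by blast
  then have "walk (G n) s ys v"
  proof (rule walk_G_hereditary)
    show "length ys = length (replicate M False @ drop M xs)"
      using False assms(5) by (simp add: M_def)
    fix i assume "i < length (replicate M False @ drop M xs)" "ys ! i"
    with assms(6)[of i] False show "(replicate M False @ drop M xs) ! i"
      by (simp add: M_def nth_append)
  qed
  then show thesis by (rule that)
qed

section \<open>Approximation in one level and in all levels\<close>

text \<open>Each full period contributes \<open>K\<close>; the unfinished one contributes what
  exceeds \<open>N - K\<close>, by truncated subtraction.\<close>

lemma card_residue_ge:
  fixes N K :: nat
  assumes "0 < N" "K \<le> N"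
  shows "card ({t. N - K \<le> t mod N} \<inter> {0..<m}) = m div N * K + (m mod N - (N - K))"
proof (induction m)
  case (Suc m)
  have "{t. N - K \<le> t mod N} \<inter> {0..<Suc m} =
      (if N - K \<le> m mod N then insert m ({t. N - K \<le> t mod N} \<inter> {0..<m}) else {t. N - K \<le> t mod N} \<inter> {0..<m})"
    by (auto simp: less_Suc_eq)
  then have card: "card ({t. N - K \<le> t mod N} \<inter> {0..<Suc m}) =
      m div N * K + (m mod N - (N - K)) + (if N - K \<le> m mod N then 1 else 0)"
    using Suc by simp
  show ?case
  proof (cases "Suc (m mod N) = N")
    case True
    then have "Suc m div N * K = m div N * K + K" "Suc m mod N = 0"
      by (auto simp: mod_Suc div_Suc)
    with card True assms show ?thesis by (cases "K = 0") auto
  next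
    case False
    then have "Suc m div N = m div N" "Suc m mod N = Suc (m mod N)"
      by (auto simp: mod_Suc div_Suc)
    with card show ?thesis by auto
  qed
qed simp

text \<open>The counted residues stand at the end of the period, so every initial segment holds at
  most its proportional share \<open>K / N\<close>, with no error term.\<close>

lemma card_residue_ge_le:
  fixes N K :: nat
  assumes "0 < N" "K \<le> N"
  shows "N * card ({t. N - K \<le> t mod N} \<inter> {0..<m}) \<le> K * m"
proof -
  have "N * (m mod N - (N - K)) \<le> K * (m mod N)"
  proof (cases "N - K \<le> m mod N")
    case True
    then obtain s where s: "m mod N = N - K + s" using le_Suc_ex by blast
    moreover have "m mod N < N" using assms by simp
    ultimately have "s \<le> K" by linarith
    have "N * s \<le> K * (N - K + s)"
    proof -
      obtain j where j: "N = K + j" using assms le_Suc_ex by blast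
      then show ?thesis using mult_right_mono[OF \<open>s \<le> K\<close>, of j] by (simp add: algebra_simps)
    qed
    with s show ?thesis by simp
  qed simp
  then have "N * (m div N * K) + N * (m mod N - (N - K)) \<le> K * (N * (m div N)) + K * (m mod N)"
    by (simp add: mult.left_commute mult.commute)
  then show ?thesis
    unfolding card_residue_ge[OF assms] distrib_left[symmetric] by simp
qed

text \<open>The walk follows the cycle and is at vertex \<open>(t + 1) mod 10 ^ n\<close> at time
  \<open>t\<close>. Starting at vertex \<open>1\<close> moves the forced zeros to the end of each
  period, as \<open>card_residue_ge_le\<close> requires.\<close>

lemma walk_G_periodic:
  assumes "\<And>t. t < l \<Longrightarrow> y t \<Longrightarrow> t mod 10 ^ n < 10 ^ n - 2 ^ n"
  shows "walk (G n) (1 mod 10 ^ n) (map y [0..<l]) ((l + 1) mod 10 ^ n)"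
  using assms
proof (induction l)
  case (Suc l)
  have "((l + 1) mod 10 ^ n, y l, (l + 2) mod 10 ^ n) \<in> G n"
  proof (cases "y l")
    case True
    then have l: "l mod 10 ^ n < 10 ^ n - 2 ^ n" using Suc.prems by simp
    have "(0::nat) < 2 ^ n" by simp
    with l have "(l + 1) mod 10 ^ n = l mod 10 ^ n + 1"
      by (subst mod_add_left_eq[symmetric]) (intro mod_less, linarith)
    moreover from this have "(l + 2) mod 10 ^ n = (l mod 10 ^ n + 1 + 1) mod 10 ^ n"
      by (metis add.assoc mod_add_left_eq one_add_one)
    ultimately show ?thesis using True l by (auto simp: G_def)
  next
    case False
    then show ?thesis using G_zero_edge[of "(l + 1) mod 10 ^ n" n] by (simp add: mod_Suc_eq)
  qed
  with Suc show ?case by (auto simp: walk_append)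
qed simp

text \<open>Plays the part of \<open>good\<close> in \<open>sparse_good_cuts\<close>. The bound on
  \<open>u\<close> matters for empty words, whose walk may sit at any number.\<close>

definition labelled :: "nat \<Rightarrow> (nat \<Rightarrow> bool) \<Rightarrow> nat \<Rightarrow> nat \<Rightarrow> bool" where
  "labelled n w a b \<longleftrightarrow> (\<exists>u v. u < 10 ^ n \<and> walk (G n) u (map w [a..<b]) v)"

text \<open>Vertex \<open>1\<close> has outgoing edges with both labels.\<close>

lemma labelled_Suc:
  assumes "n \<ge> 1"
  shows "labelled n w a (Suc a)"
proof -
  have one: "1 < (10::nat) ^ n" using assms by (intro one_less_power) auto
  have "(2::nat) ^ n < 10 ^ n" using assms by (intro power_strict_mono) auto
  then have "(1, w a, (1 + 1) mod 10 ^ n) \<in> G n"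
    using G_zero_edge[OF one] by (cases "w a") (auto simp: G_def)
  moreover note one
  ultimately show ?thesis unfolding labelled_def by auto
qed

lemma labelled_if_Z_level:
  assumes "y \<in> Z_level n" "\<And>i. i < l \<Longrightarrow> y i = w (a + i)"
  shows "labelled n w a (a + l)"
proof -
  obtain e where e: "infinite_path (G n) e" "y = (\<lambda>i. fst (snd (e i)))"
    using assms(1) by (auto simp: Z_level_def presented_shift_def)
  have "walk (G n) (fst (e 0)) (map y [0..<0 + l]) (fst (e (0 + l)))"
    unfolding e(2) by (rule walk_of_infinite_path[OF e(1)])
  moreover have "map y [0..<0 + l] = map w [a..<a + l]"
    using assms(2) by (intro nth_equalityI) auto
  moreover have "e 0 \<in> G n" using e by (simp add: infinite_path_def)
  then have "fst (e 0) < 10 ^ n" by (metis G_source_less prod.collapse)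
  ultimately show ?thesis unfolding labelled_def by metis
qed

text \<open>
  The uniform bound, obtained by imposing a periodic zero pattern on a long initial segment, makes
  the exceptional sets summable over \<open>n\<close>.
\<close>

lemma Z_level_approx:
  assumes n: "n \<ge> 1" and rare: "\<And>l. null_set {a. \<not> labelled n w a (a + l)}"
  obtains y where "y \<in> Z_level n" "null_set {i. y i \<noteq> w i}"
    "\<And>m. real (card ({i. y i \<noteq> w i} \<inter> {0..<m})) \<le> 2 * (1 / 5) ^ n * real m"
proof -
  define N K M :: nat where "N = 10 ^ n" and "K = 2 ^ n" and "M = 2 * 10 ^ n * 10 ^ n"
  have NK: "0 < N" "K \<le> N" by (auto simp: N_def K_def power_mono)
  have ratio: "real K / real N = (1 / 5) ^ n"
    by (simp add: N_def K_def power_divide[symmetric])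
  obtain a where a: "strict_mono a" "\<And>i. labelled n w (a i) (a (Suc i))" "null_set (range a)"
    using sparse_good_cuts[of "labelled n w"] labelled_Suc[OF n] rare by blast
  \<comment> \<open>\<open>D\<close> consists of the \<open>M\<close> positions from each cut on,
    \<open>M\<close> being the length of the zero words in \<open>walk_G_transition\<close>.\<close>
  define D where "D = (\<Union>k<M. (\<lambda>i. i + k) ` range a)"
  have "null_set D"
    unfolding D_def by (intro null_set_UN null_set_plus a) auto
  then obtain m0 where m0: "\<And>m. m \<ge> m0 \<Longrightarrow> real (card (D \<inter> {0..<m})) \<le> (1 / 5) ^ n * real m"
    using null_setD[of D "(1 / 5) ^ n"] by auto
  define P where "P = {t. N - K \<le> t mod N}"
  \<comment> \<open>The change of pattern happens at the cut \<open>a m0\<close>, where a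
    resynchronisation can start; since \<open>m0 <= a m0\<close>, the density bound for
    \<open>D\<close> already holds there.\<close>
  define y where "y i \<longleftrightarrow> w i \<and> (if i < a m0 then i \<notin> P else i \<notin> D)" for i
  have a_ge: "i \<le> a i" for i using strict_mono_imp_increasing[OF a(1)] .
  have walk_cut: "\<exists>t. walk (G n) (1 mod 10 ^ n) (map y [0..<a j]) t" if "m0 \<le> j" for j
    using that
  proof (induction j rule: dec_induct)
    case base
    have "walk (G n) (1 mod 10 ^ n) (map y [0..<a m0]) ((a m0 + 1) mod 10 ^ n)"
      by (rule walk_G_periodic) (auto simp: y_def P_def N_def K_def)
    then show ?case ..
  next
    case (step j)
    then obtain s where s: "walk (G n) (1 mod 10 ^ n) (map y [0..<a j]) s" by blast
    obtain u v where uv: "u < 10 ^ n" "walk (G n) u (map w [a j..<a (Suc j)]) v"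
      using a(2)[of j] by (auto simp: labelled_def)
    have less: "a j < a (Suc j)" using a(1) by (simp add: strict_mono_Suc_iff)
    have s': "s < 10 ^ n" by (rule walk_G_target_less[OF s mod_less_divisor]) simp
    obtain t where "walk (G n) s (map y [a j..<a (Suc j)]) t"
    proof (rule walk_G_resync[OF n uv(2,1) s', of "map y [a j..<a (Suc j)]"])
      fix i assume i: "i < length (map w [a j..<a (Suc j)])" "map y [a j..<a (Suc j)] ! i"
      then have "y (a j + i)" by simp
      moreover have "a m0 \<le> a j" using step a(1) by (simp add: strict_mono_less_eq)
      ultimately have y: "w (a j + i)" "a j + i \<notin> D" by (auto simp: y_def)
      then have "M \<le> i" unfolding D_def by fastforce
      with i y show "map w [a j..<a (Suc j)] ! i \<and> 2 * 10 ^ n * 10 ^ n \<le> i"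
        by (simp add: M_def)
    qed auto
    then have "walk (G n) (1 mod 10 ^ n) (map y [0..<a j] @ map y [a j..<a (Suc j)]) t"
      using s walk_append by blast
    then show ?case
      using less upt_add_eq_append[of 0 "a j" "a (Suc j) - a j"] by (auto simp flip: map_append)
  qed
  show thesis
  proof (rule that[of y])
    show "y \<in> Z_level n"
    proof (rule Z_level_if_all_walks)
      fix m
      have m: "m \<le> a (m0 + m)" using a_ge[of "m0 + m"] by simp
      obtain t where t: "walk (G n) (1 mod 10 ^ n) (map y [0..<a (m0 + m)]) t"
        using walk_cut[of "m0 + m"] by auto
      have "map y [0..<a (m0 + m)] = map y [0..<m] @ map y [m..<a (m0 + m)]"
        using m upt_add_eq_append[of 0 m "a (m0 + m) - m"] by (simp flip: map_append)
      with t obtain v where "walk (G n) (1 mod 10 ^ n) (map y [0..<m]) v"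
        by (auto simp: walk_append)
      then show "\<exists>u v. u < 10 ^ n \<and> walk (G n) u (map y [0..<m]) v"
        using mod_less_divisor[of "10 ^ n" 1, OF zero_less_power[OF zero_less_numeral]] by blast
    qed
    show "null_set {i. y i \<noteq> w i}"
      by (rule null_set_subset[OF null_set_Un[OF null_set_finite[of "{..<a m0}"] \<open>null_set D\<close>]])
        (auto simp: y_def split: if_splits)
    fix m
    have "real N * real (card (P \<inter> {0..<m})) \<le> real K * real m"
      using card_residue_ge_le[OF NK, of m] unfolding P_def by (metis of_nat_le_iff of_nat_mult)
    then have P: "real (card (P \<inter> {0..<m})) \<le> (1 / 5) ^ n * real m"
      unfolding ratio[symmetric] using NK by (simp add: field_simps)
    \<comment> \<open>Up to \<open>a m0\<close> only \<open>P\<close> causes errors; beyond it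
      \<open>P\<close> and \<open>D\<close> together do, each with share at most
      \<open>(1 / 5) ^ n\<close>.\<close>
    show "real (card ({i. y i \<noteq> w i} \<inter> {0..<m})) \<le> 2 * (1 / 5) ^ n * real m"
    proof (cases "m \<le> a m0")
      case True
      then have "card ({i. y i \<noteq> w i} \<inter> {0..<m}) \<le> card (P \<inter> {0..<m})"
        by (intro card_mono) (auto simp: y_def)
      moreover have "0 \<le> (1 / 5) ^ n * real m" by simp
      ultimately show ?thesis using P by linarith
    next
      case False
      then have "m0 \<le> m" using a_ge[of m0] by linarith
      have "card ({i. y i \<noteq> w i} \<inter> {0..<m}) \<le> card (P \<inter> {0..<m}) + card (D \<inter> {0..<m})"
        by (intro order_trans[OF card_mono card_Un_le]) (auto simp: y_def split: if_splits)
      with P m0[OF \<open>m0 \<le> m\<close>] show ?thesis by linarith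
    qed
  qed
qed

text \<open>The minimum \<open>z\<close> of \<open>w\<close> and all approximations lies below each
  of them, and it can differ from \<open>w\<close> only in the union of their exceptional sets,
  which is null by domination.\<close>

lemma Z_approx:
  assumes "\<And>n l. n \<ge> 1 \<Longrightarrow> null_set {a. \<not> labelled n w a (a + l)}"
  obtains z where "z \<in> Z" "null_set {i. z i \<noteq> w i}"
proof -
  \<comment> \<open>Levels start at 1, whence \<open>Suc n\<close>.\<close>
  let ?Q = "\<lambda>n y. y \<in> Z_level (Suc n) \<and> null_set {i. y i \<noteq> w i} \<and>
    (\<forall>m. real (card ({i. y i \<noteq> w i} \<inter> {0..<m})) \<le> 2 * (1 / 5) ^ Suc n * real m)"
  have "\<exists>y. ?Q n y" for n
  proof -
    have "null_set {a. \<not> labelled (Suc n) w a (a + l)}" for l by (rule assms) simp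
    with le_add1[of 1 n, folded Suc_eq_plus1_left] obtain y where "y \<in> Z_level (Suc n)"
      "null_set {i. y i \<noteq> w i}"
      "\<And>m. real (card ({i. y i \<noteq> w i} \<inter> {0..<m})) \<le> 2 * (1 / 5) ^ Suc n * real m"
      by (rule Z_level_approx) blast
    then show ?thesis by blast
  qed
  then have "\<forall>n. \<exists>y. ?Q n y" ..
  then have "\<exists>y. \<forall>n. ?Q n (y n)" by (rule choice)
  then obtain y where y: "\<And>n. y n \<in> Z_level (Suc n)" "\<And>n. null_set {i. y n i \<noteq> w i}"
    "\<And>n m. real (card ({i. y n i \<noteq> w i} \<inter> {0..<m})) \<le> 2 * (1 / 5) ^ Suc n * real m"
    by blast
  define z where "z i \<longleftrightarrow> w i \<and> (\<forall>n. y n i)" for i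
  have "z \<in> Z_level n" if "n \<ge> 1" for n
    using Z_level_hereditary[OF y(1)[of "n - 1"], of z] that by (auto simp: z_def)
  then have "z \<in> Z" by (simp add: Z_def)
  moreover have "null_set (\<Union>n. {i. y n i \<noteq> w i})"
    by (rule null_set_UN_dominated[OF y(2,3)])
      (intro summable_mult summable_ignore_initial_segment[of _ 1, simplified] summable_geometric, simp)
  then have "null_set {i. z i \<noteq> w i}"
    by (rule null_set_subset) (auto simp: z_def)
  ultimately show thesis by (rule that)
qed

section \<open>Vague pseudo-orbits and their sequences of first symbols\<close>

lemma funpow_shift: "(shift ^^ n) x i = x (n + i)"
  by (induction n arbitrary: i) (auto simp: shift_def)

text \<open>Agreement of \<open>y 0\<close> with the first symbols of
  \<open>y 0, ..., y (l - 1)\<close> involves finitely many coordinates and holds on true orbits, so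
  it defines an open neighbourhood of them to which the definition applies.\<close>

lemma vague_pseudo_orbit_agreement:
  assumes "shift_space X" "vague_pseudo_orbit X x"
  shows "null_set {n. \<exists>i<l. x n i \<noteq> x (n + i) 0}"
proof -
  have cont: "continuous_on UNIV (\<lambda>y :: nat \<Rightarrow> nat \<Rightarrow> bool. y k i)" for k i
    by (rule continuous_on_compose2[where g = "\<lambda>y. y i" and t = UNIV])
      (auto intro: continuous_on_product_coordinates)
  let ?V = "{y :: nat \<Rightarrow> nat \<Rightarrow> bool. \<forall>i<l. y 0 i = y i 0}"
  have V: "?V = (\<Inter>i<l. (\<lambda>y. (y 0 i, y i 0)) -` {p. fst p = snd p})" by auto
  have "open {p :: bool \<times> bool. fst p = snd p}"
  proof -
    have "{p :: bool \<times> bool. fst p = snd p} = {True} \<times> {True} \<union> {False} \<times> {False}"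
      by auto
    then show ?thesis by (simp only:) (intro open_Un open_Times open_discrete)
  qed
  then have "open ?V"
    unfolding V by (intro open_INT ballI open_vimage continuous_on_Pair cont) auto
  then have "openin (top_of_set (point_seqs X)) (point_seqs X \<inter> ?V)"
    by (rule openin_open_Int)
  moreover have "(shift ^^ n) z \<in> X" if "z \<in> X" for n z
    using that assms(1) by (induction n) (auto simp: shift_space_def)
  then have "orbit_seqs X \<subseteq> point_seqs X \<inter> ?V"
    by (auto simp: orbit_seqs_def point_seqs_def funpow_shift)
  ultimately have "density_one {n. (shift ^^ n) x \<in> point_seqs X \<inter> ?V}"
    using assms(2) unfolding vague_pseudo_orbit_def by blast
  then have "null_set (- {n. (shift ^^ n) x \<in> point_seqs X \<inter> ?V})"
    by (simp only: density_one_iff_null_set)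
  then show ?thesis
    by (rule null_set_subset) (auto simp: funpow_shift)
qed

lemma rho_less:
  assumes "\<And>i. i < l \<Longrightarrow> x i = y i" "(1 / 2) ^ l < \<epsilon>"
  shows "rho x y < \<epsilon>"
proof (cases "x = y")
  case True
  have "0 < \<epsilon>" by (rule le_less_trans[OF _ assms(2)]) simp
  with True show ?thesis by (simp add: rho_def)
next
  case False
  then have "\<exists>n. x n \<noteq> y n" by auto
  then have "x (LEAST n. x n \<noteq> y n) \<noteq> y (LEAST n. x n \<noteq> y n)" by (rule LeastI_ex)
  then have "l \<le> (LEAST n. x n \<noteq> y n)"
    using assms(1) not_le by blast
  then have "(1 / 2 :: real) ^ (LEAST n. x n \<noteq> y n) \<le> (1 / 2) ^ l"
    by (intro power_decreasing) auto
  then have "rho x y \<le> (1 / 2) ^ l" using False by (simp only: rho_def if_False)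
  then show ?thesis using assms(2) by (rule le_less_trans)
qed

theorem corollary6p3:
  shows "vague_specification Z"
  unfolding vague_specification_def
proof (intro allI impI)
  fix x assume x: "vague_pseudo_orbit Z x"
  define w where "w n = x n 0" for n
  define B where "B l = {n. \<exists>i<l. x n i \<noteq> w (n + i)}" for l
  have B: "null_set (B l)" for l
    using vague_pseudo_orbit_agreement[OF shift_space_Z x] by (simp add: B_def w_def)
  \<comment> \<open>Outside \<open>B l\<close> the window of \<open>w\<close> at \<open>a\<close> is
    a prefix of \<open>x a\<close>, a point of \<open>Z_level n\<close>.\<close>
  have "null_set {a. \<not> labelled n w a (a + l)}" if "n \<ge> 1" for n l
  proof (rule null_set_subset[OF B[of l]], rule subsetI, rule ccontr)
    fix a assume a: "a \<in> {a. \<not> labelled n w a (a + l)}" "a \<notin> B l"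
    have "x a \<in> Z_level n"
      using x that by (auto simp: vague_pseudo_orbit_def point_seqs_def Z_def)
    with a show False using labelled_if_Z_level[of "x a" n l w a] by (auto simp: B_def)
  qed
  then obtain z where z: "z \<in> Z" "null_set {i. z i \<noteq> w i}" using Z_approx by blast
  show "\<exists>z\<in>Z. \<forall>\<epsilon>>0. density_one {n. rho ((shift ^^ n) z) (x n) < \<epsilon>}"
  proof (intro bexI[OF _ z(1)] allI impI)
    fix \<epsilon> :: real assume "\<epsilon> > 0"
    then obtain l where l: "(1 / 2) ^ l < \<epsilon>" using real_arch_pow_inv[of \<epsilon> "1 / 2"] by auto
    \<comment> \<open>Outside this set the first \<open>l\<close> symbols of the shifted
      \<open>z\<close> equal the window of \<open>w\<close> at \<open>n\<close>, which is the prefix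
      of \<open>x n\<close>.\<close>
    have "null_set (B l \<union> (\<Union>i<l. {n. n + i \<in> {i. z i \<noteq> w i}}))"
      by (intro null_set_Un B null_set_UN null_set_minus z) auto
    moreover have "- {n. rho ((shift ^^ n) z) (x n) < \<epsilon>} \<subseteq> B l \<union> (\<Union>i<l. {n. n + i \<in> {i. z i \<noteq> w i}})"
    proof (rule subsetI, rule ccontr)
      fix n assume n: "n \<in> - {n. rho ((shift ^^ n) z) (x n) < \<epsilon>}"
        "n \<notin> B l \<union> (\<Union>i<l. {n. n + i \<in> {i. z i \<noteq> w i}})"
      then have "(shift ^^ n) z i = x n i" if "i < l" for i
        using that by (auto simp: B_def funpow_shift)
      from rho_less[OF this l] n(1) show False by simp
    qed
    ultimately have "null_set (- {n. rho ((shift ^^ n) z) (x n) < \<epsilon>})"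
      by (rule null_set_subset)
    then show "density_one {n. rho ((shift ^^ n) z) (x n) < \<epsilon>}"
      by (simp add: density_one_iff_null_set)
  qed
qed

end
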